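(* The following generating tensors are sufficient to simulate any stabilizer quantum circuit: (a) the vector $|t\rangle=|0\rangle+i|1\rangle$; (b) the Hadamard gate; (c) the XOR tensor and the COPY tensor; (d) the covector $\langle +|=\langle 0|+\langle 1|$. That is, for every $n$ and every stabilizer circuit on $n$ qubits with associated operator $U$ on $(\mathbb{C}^2)^{\otimes n}$, there is a tensor network built from the tensors (a)-(d) whose contraction equals $c\,U$ for some nonzero $c\in\mathbb{C}$.
   Context: The Hadamard gate is $H=\frac{1}{\sqrt2}(X+Z)$. The COPY tensor is the linear map $\mathbb{C}^2\to\mathbb{C}^2\otimes\mathbb{C}^2$, $|a\rangle\mapsto|a,a\rangle$ ($a\in\{0,1\}$). The XOR tensor is the linear map $\mathbb{C}^2\otimes\mathbb{C}^2\to\mathbb{C}^2$, $|a,b\rangle\mapsto|a\oplus b\rangle$. The vector $|t\rangle$ is viewed as a map $\mathbb{C}\to\mathbb{C}^2$ and $\langle+|$ as a map $\mathbb{C}^2\to\mathbb{C}$. A tensor network built from given tensors is any linear map obtained from them, the identity wire and the wire swap by composition and tensor product. A stabilizer circuit on $n$ qubits is a finite composition of gates, each acting on one or two of the $n$ qubits and chosen among: the Pauli gates $X,Y,Z$; the Hadamard gate; the phase gate $P=|0\rangle\langle0|+i|1\rangle\langle1|$; and the controlled-NOT (Feynman) gate $|a,b\rangle\mapsto|a,a\oplus b\rangle$. *)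

theory Defs
  imports Complex_Main "Jordan_Normal_Form.Matrix"
begin

text \<open>
  A linear map from $m$ qubits to $n$ qubits is given by its $2^n \times 2^m$ matrix in the
  computational basis, where $|b_0, \dots, b_{n-1}\rangle$ has index
  $b_0 2^{n-1} + \dots + b_{n-1} 2^0$: qubit 0 is the most significant bit.
\<close>

definition qubit :: "nat \<Rightarrow> nat \<Rightarrow> nat \<Rightarrow> bool" where
  "qubit n r k \<longleftrightarrow> bit r (n - 1 - k)"

definition ket_index :: "bool list \<Rightarrow> nat" where
  "ket_index bs = horner_sum of_bool 2 (rev bs)"

definition tensor_prod :: "complex mat \<Rightarrow> complex mat \<Rightarrow> complex mat" (infixr "\<otimes>\<^sub>m" 72) where
  "A \<otimes>\<^sub>m B = mat (dim_row A * dim_row B) (dim_col A * dim_col B)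
     (\<lambda>(i, j). A $$ (i div dim_row B, j div dim_col B) * B $$ (i mod dim_row B, j mod dim_col B))"

definition pauli_X :: "complex mat" where
  "pauli_X = mat_of_rows_list 2 [[0, 1], [1, 0]]"

definition pauli_Y :: "complex mat" where
  "pauli_Y = mat_of_rows_list 2 [[0, - \<i>], [\<i>, 0]]"

definition pauli_Z :: "complex mat" where
  "pauli_Z = mat_of_rows_list 2 [[1, 0], [0, - 1]]"

definition hadamard :: "complex mat" where
  "hadamard = complex_of_real (1 / sqrt 2) \<cdot>\<^sub>m (pauli_X + pauli_Z)"

definition phase_gate :: "complex mat" where
  "phase_gate = mat_of_rows_list 2 [[1, 0], [0, \<i>]]"

definition cnot :: "complex mat" where
  "cnot = mat_of_rows_list 4
     [[1, 0, 0, 0],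
      [0, 1, 0, 0],
      [0, 0, 0, 1],
      [0, 0, 1, 0]]"

definition wire :: "complex mat" where
  "wire = 1\<^sub>m 2"

definition wire_swap :: "complex mat" where
  "wire_swap = mat_of_rows_list 4
     [[1, 0, 0, 0],
      [0, 0, 1, 0],
      [0, 1, 0, 0],
      [0, 0, 0, 1]]"

definition copy_tensor :: "complex mat" where
  "copy_tensor = mat_of_rows_list 2
     [[1, 0],
      [0, 0],
      [0, 0],
      [0, 1]]"

definition xor_tensor :: "complex mat" where
  "xor_tensor = mat_of_rows_list 4
     [[1, 0, 0, 1],
      [0, 1, 1, 0]]"

definition t_vector :: "complex mat" where
  "t_vector = mat_of_rows_list 1 [[1], [\<i>]]"

definition plus_covector :: "complex mat" where
  "plus_covector = mat_of_rows_list 2 [[1, 1]]"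

text \<open>All matrices arising below have dimensions that are powers of 2, so equality of the inner
  dimensions is equality of the numbers of wires.\<close>

inductive_set tensor_networks :: "complex mat set \<Rightarrow> complex mat set" for T where
  gen: "A \<in> T \<Longrightarrow> A \<in> tensor_networks T"
| wire: "wire \<in> tensor_networks T"
| swap: "wire_swap \<in> tensor_networks T"
| comp: "A \<in> tensor_networks T \<Longrightarrow> B \<in> tensor_networks T \<Longrightarrow> dim_col A = dim_row B
    \<Longrightarrow> A * B \<in> tensor_networks T"
| tensor: "A \<in> tensor_networks T \<Longrightarrow> B \<in> tensor_networks T \<Longrightarrow> A \<otimes>\<^sub>m B \<in> tensor_networks T"

definition generating_tensors :: "complex mat set" where
  "generating_tensors = {t_vector, hadamard, xor_tensor, copy_tensor, plus_covector}"

text \<open>For a list \<open>qs\<close> of distinct qubits, the operator on \<open>n\<close> qubits that acts as \<open>A\<close> on the qubits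
  \<open>qs\<close>, taken in this order, and as the identity on the others.\<close>

definition on_qubits :: "nat \<Rightarrow> nat list \<Rightarrow> complex mat \<Rightarrow> complex mat" where
  "on_qubits n qs A = mat (2 ^ n) (2 ^ n) (\<lambda>(r, c).
     if \<forall>k<n. k \<notin> set qs \<longrightarrow> qubit n r k = qubit n c k
     then A $$ (ket_index (map (qubit n r) qs), ket_index (map (qubit n c) qs))
     else 0)"

datatype stabilizer_gate =
    Pauli_X nat
  | Pauli_Y nat
  | Pauli_Z nat
  | Hadamard nat
  | Phase nat
  | CNOT nat nat \<comment> \<open>control, target\<close>

fun valid_gate :: "nat \<Rightarrow> stabilizer_gate \<Rightarrow> bool" where
  "valid_gate n (Pauli_X i) \<longleftrightarrow> i < n"
| "valid_gate n (Pauli_Y i) \<longleftrightarrow> i < n"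
| "valid_gate n (Pauli_Z i) \<longleftrightarrow> i < n"
| "valid_gate n (Hadamard i) \<longleftrightarrow> i < n"
| "valid_gate n (Phase i) \<longleftrightarrow> i < n"
| "valid_gate n (CNOT i j) \<longleftrightarrow> i < n \<and> j < n \<and> i \<noteq> j"

fun gate_operator :: "nat \<Rightarrow> stabilizer_gate \<Rightarrow> complex mat" where
  "gate_operator n (Pauli_X i) = on_qubits n [i] pauli_X"
| "gate_operator n (Pauli_Y i) = on_qubits n [i] pauli_Y"
| "gate_operator n (Pauli_Z i) = on_qubits n [i] pauli_Z"
| "gate_operator n (Hadamard i) = on_qubits n [i] hadamard"
| "gate_operator n (Phase i) = on_qubits n [i] phase_gate"
| "gate_operator n (CNOT i j) = on_qubits n [i, j] cnot"

definition stabilizer_circuit :: "nat \<Rightarrow> stabilizer_gate list \<Rightarrow> bool" where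
  "stabilizer_circuit n gs \<longleftrightarrow> (\<forall>g \<in> set gs. valid_gate n g)"

text \<open>The head of the list is the gate that is applied first.\<close>

fun circuit_operator :: "nat \<Rightarrow> stabilizer_gate list \<Rightarrow> complex mat" where
  "circuit_operator n [] = 1\<^sub>m (2 ^ n)"
| "circuit_operator n (g # gs) = circuit_operator n gs * gate_operator n g"

end

theory Submission
  imports Defs "HOL-Combinatorics.Transposition"
begin

text \<open>
  Up to nonzero scalars, merging two wires with the transposed COPY tensor is
  \<open>H \<cdot> XOR \<cdot> (H \<otimes> H)\<close>. Feeding \<open>|t\<rangle>\<close> into one of its inputs gives the phase gate \<open>P\<close>, and then
  \<open>Z = P\<^sup>2\<close>, \<open>X = H Z H\<close> and \<open>Y = \<i> X Z\<close>. The controlled-NOT gate is \<open>(1 \<otimes> XOR) (COPY \<otimes> 1)\<close>.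
  A gate on adjacent qubits is placed in the circuit by tensoring with identities, and one on
  arbitrary qubits by conjugating with wire swaps. The scalar \<open>\<langle>+|t\<rangle> = 1 + \<i>\<close> provides the
  network without wires.
\<close>

section \<open>Closure properties of simulability up to a nonzero scalar\<close>

definition simulable :: "complex mat \<Rightarrow> bool" where
  "simulable A \<longleftrightarrow> (\<exists>c. c \<noteq> 0 \<and> c \<cdot>\<^sub>m A \<in> tensor_networks generating_tensors)"

lemma simulable_network:
  assumes "A \<in> tensor_networks generating_tensors"
  shows "simulable A"
proof -
  have "1 \<cdot>\<^sub>m A = A" by (intro eq_matI) auto
  with assms show ?thesis unfolding simulable_def by (intro exI[of _ 1]) simp
qed

text \<open>This discards scalars such as \<open>2 * sqrt_half\<close> or \<open>- \<i>\<close>: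
  once a network is computed to be a nonzero multiple of a gate, the gate itself counts as simulable
  and the factor need not be tracked any further.\<close>

lemma simulable_smult:
  assumes "simulable (d \<cdot>\<^sub>m A)" "d \<noteq> 0"
  shows "simulable A"
proof -
  obtain c where c: "c \<noteq> 0" "c \<cdot>\<^sub>m (d \<cdot>\<^sub>m A) \<in> tensor_networks generating_tensors"
    using assms unfolding simulable_def by auto
  have "c \<cdot>\<^sub>m (d \<cdot>\<^sub>m A) = (c * d) \<cdot>\<^sub>m A" by (intro eq_matI) auto
  with c assms(2) show ?thesis unfolding simulable_def by (intro exI[of _ "c * d"]) simp
qed

lemma simulable_mult:
  assumes "simulable A" "simulable B" "dim_col A = dim_row B"
  shows "simulable (A * B)"
proof -
  obtain c d where c: "c \<noteq> 0" "c \<cdot>\<^sub>m A \<in> tensor_networks generating_tensors"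
    and d: "d \<noteq> 0" "d \<cdot>\<^sub>m B \<in> tensor_networks generating_tensors"
    using assms unfolding simulable_def by auto
  have "(c \<cdot>\<^sub>m A) * (d \<cdot>\<^sub>m B) = (c * d) \<cdot>\<^sub>m (A * B)"
    using assms(3) by (intro eq_matI) (auto simp: scalar_prod_def sum_distrib_left mult_ac)
  moreover have "(c \<cdot>\<^sub>m A) * (d \<cdot>\<^sub>m B) \<in> tensor_networks generating_tensors"
    using c d assms(3) by (intro tensor_networks.comp) auto
  ultimately show ?thesis
    using c d unfolding simulable_def by (intro exI[of _ "c * d"]) simp
qed

lemma dim_tensor_prod [simp]:
  "dim_row (A \<otimes>\<^sub>m B) = dim_row A * dim_row B"
  "dim_col (A \<otimes>\<^sub>m B) = dim_col A * dim_col B"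
  by (auto simp: tensor_prod_def)

lemma index_tensor_prod:
  assumes "i < dim_row A * dim_row B" "j < dim_col A * dim_col B"
  shows "(A \<otimes>\<^sub>m B) $$ (i, j) =
    A $$ (i div dim_row B, j div dim_col B) * B $$ (i mod dim_row B, j mod dim_col B)"
  using assms by (simp add: tensor_prod_def)

lemma div_mod_bounds:
  assumes "i < a * (b :: nat)"
  shows "i div b < a" "i mod b < b"
  using assms by (simp add: less_mult_imp_div_less)
    (metis assms mod_less_divisor mult_0_right neq0_conv not_less0)

lemma simulable_tensor_prod:
  assumes "simulable A" "simulable B"
  shows "simulable (A \<otimes>\<^sub>m B)"
proof -
  obtain c d where c: "c \<noteq> 0" "c \<cdot>\<^sub>m A \<in> tensor_networks generating_tensors"
    and d: "d \<noteq> 0" "d \<cdot>\<^sub>m B \<in> tensor_networks generating_tensors"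
    using assms unfolding simulable_def by auto
  have "(c \<cdot>\<^sub>m A) \<otimes>\<^sub>m (d \<cdot>\<^sub>m B) = (c * d) \<cdot>\<^sub>m (A \<otimes>\<^sub>m B)"
    by (intro eq_matI) (auto simp: index_tensor_prod div_mod_bounds)
  moreover have "(c \<cdot>\<^sub>m A) \<otimes>\<^sub>m (d \<cdot>\<^sub>m B) \<in> tensor_networks generating_tensors"
    using c d by (intro tensor_networks.tensor)
  ultimately show ?thesis
    using c d unfolding simulable_def by (intro exI[of _ "c * d"]) simp
qed

section \<open>Elementary gates\<close>

lemma simulable_generators:
  "simulable t_vector" "simulable hadamard" "simulable xor_tensor" "simulable copy_tensor"
  "simulable plus_covector" "simulable wire" "simulable wire_swap"
  by (auto intro!: simulable_network tensor_networks.intros simp: generating_tensors_def)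

lemmas tensor_defs = pauli_X_def pauli_Y_def pauli_Z_def hadamard_def phase_gate_def cnot_def
  wire_def wire_swap_def copy_tensor_def xor_tensor_def t_vector_def plus_covector_def

lemma dim_tensors [simp]:
  "dim_row pauli_X = 2" "dim_col pauli_X = 2" "dim_row pauli_Y = 2" "dim_col pauli_Y = 2"
  "dim_row pauli_Z = 2" "dim_col pauli_Z = 2" "dim_row hadamard = 2" "dim_col hadamard = 2"
  "dim_row phase_gate = 2" "dim_col phase_gate = 2" "dim_row cnot = 4" "dim_col cnot = 4"
  "dim_row wire = 2" "dim_col wire = 2" "dim_row wire_swap = 4" "dim_col wire_swap = 4"
  "dim_row copy_tensor = 4" "dim_col copy_tensor = 2"
  "dim_row xor_tensor = 2" "dim_col xor_tensor = 4"
  "dim_row t_vector = 2" "dim_col t_vector = 1"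
  "dim_row plus_covector = 1" "dim_col plus_covector = 2"
  by (simp_all add: tensor_defs mat_of_rows_list_def)

text \<open>Ranging over explicit lists of indices lets \<open>upt_rec\<close> unfold the equality
  of two concrete matrices into finitely many entry equations for the simplifier.\<close>

lemma eq_mat_entriesI:
  assumes "dim_row A = m" "dim_row B = m" "dim_col A = n" "dim_col B = n"
    and "list_all (\<lambda>i. list_all (\<lambda>j. A $$ (i, j) = B $$ (i, j)) [0..<n]) [0..<m]"
  shows "A = B"
  using assms by (intro eq_matI) (auto simp: list_all_iff)

text \<open>The matrix products evaluated below have inner dimension 2, 4 or 8; these equations turn
  their scalar products into explicit sums.\<close>

lemma atLeastLessThan_0_8: "{0..<8 :: nat} = {0, 1, 2, 3, 4, 5, 6, 7}" by auto
lemma atLeastLessThan_0_4: "{0..<4 :: nat} = {0, 1, 2, 3}" by auto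
lemma atLeastLessThan_0_2: "{0..<2 :: nat} = {0, 1}" by auto

lemmas compute = upt_rec numeral_2_eq_2[symmetric] scalar_prod_def index_tensor_prod
  atLeastLessThan_0_2 atLeastLessThan_0_4 atLeastLessThan_0_8

lemma dim_mat_of_rows_list [simp]:
  "dim_row (mat_of_rows_list n rs) = length rs" "dim_col (mat_of_rows_list n rs) = n"
  by (simp_all add: mat_of_rows_list_def)

lemma index_mat_of_rows_list [simp]:
  "i < length rs \<Longrightarrow> j < n \<Longrightarrow> mat_of_rows_list n rs $$ (i, j) = rs ! i ! j"
  by (simp add: mat_of_rows_list_def)

text \<open>Naming this constant keeps square roots out of the entrywise computations, which use
  only that its square is 1/2.\<close>

definition sqrt_half :: complex where
  "sqrt_half = complex_of_real (1 / sqrt 2)"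

lemma sqrt_half_square: "sqrt_half * sqrt_half = 1 / 2"
  unfolding sqrt_half_def by (simp flip: of_real_mult)

lemma sqrt_half_nonzero: "sqrt_half \<noteq> 0"
  by (simp add: sqrt_half_def)

lemma hadamard_eq: "hadamard = sqrt_half \<cdot>\<^sub>m mat_of_rows_list 2 [[1, 1], [1, - 1]]"
  unfolding hadamard_def sqrt_half_def[symmetric]
  by (intro eq_mat_entriesI[of _ 2 _ 2]) (simp_all add: pauli_X_def pauli_Z_def compute)

text \<open>A diagonal gate multiplies amplitudes pointwise by a fixed vector, here (1, i), the
  amplitudes of \<open>t_vector\<close>. The Hadamard gate is the Fourier transform on Z/2, which
  turns pointwise multiplication into convolution, and convolution is what \<open>xor_tensor\<close>
  computes.\<close>

lemma simulable_phase_gate: "simulable phase_gate"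
proof -
  \<comment> \<open>The network is evaluated from its innermost product outwards, with every
    intermediate result as an explicit matrix, so that each entrywise check stays small.\<close>
  have T: "t_vector \<otimes>\<^sub>m wire = mat_of_rows_list 2 [[1, 0], [0, 1], [\<i>, 0], [0, \<i>]]"
    by (intro eq_mat_entriesI[of _ 4 _ 2]) (simp_all add: tensor_defs compute)
  have HH: "hadamard \<otimes>\<^sub>m hadamard = mat_of_rows_list 4
      [[1/2, 1/2, 1/2, 1/2], [1/2, - 1/2, 1/2, - 1/2],
       [1/2, 1/2, - 1/2, - 1/2], [1/2, - 1/2, - 1/2, 1/2]]"
    unfolding hadamard_eq
    by (intro eq_mat_entriesI[of _ 4 _ 4]) (simp_all add: compute sqrt_half_square)
  have M: "(hadamard \<otimes>\<^sub>m hadamard) * (t_vector \<otimes>\<^sub>m wire) = mat_of_rows_list 2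
      [[(1 + \<i>) / 2, (1 + \<i>) / 2], [(1 + \<i>) / 2, - (1 + \<i>) / 2],
       [(1 - \<i>) / 2, (1 - \<i>) / 2], [(1 - \<i>) / 2, - (1 - \<i>) / 2]]"
    unfolding T HH
    by (intro eq_mat_entriesI[of _ 4 _ 2]) (simp_all add: compute field_simps)
  have X: "xor_tensor * ((hadamard \<otimes>\<^sub>m hadamard) * (t_vector \<otimes>\<^sub>m wire)) =
      mat_of_rows_list 2 [[1, \<i>], [1, - \<i>]]"
    unfolding M xor_tensor_def
    by (intro eq_mat_entriesI[of _ 2 _ 2]) (simp_all add: compute field_simps)
  have "hadamard * (xor_tensor * ((hadamard \<otimes>\<^sub>m hadamard) * (t_vector \<otimes>\<^sub>m wire)))
    = (2 * sqrt_half) \<cdot>\<^sub>m phase_gate"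
    unfolding X unfolding hadamard_eq phase_gate_def
    by (intro eq_mat_entriesI[of _ 2 _ 2]) (simp_all add: compute)
  moreover have "simulable (hadamard * (xor_tensor * ((hadamard \<otimes>\<^sub>m hadamard) * (t_vector \<otimes>\<^sub>m wire))))"
    by (intro simulable_mult simulable_tensor_prod simulable_generators) auto
  ultimately show ?thesis
    using sqrt_half_nonzero simulable_smult[of "2 * sqrt_half" phase_gate] by auto
qed

lemma simulable_pauli_Z: "simulable pauli_Z"
proof -
  have "phase_gate * phase_gate = pauli_Z"
    by (intro eq_mat_entriesI[of _ 2 _ 2]) (simp_all add: phase_gate_def pauli_Z_def compute)
  moreover have "simulable (phase_gate * phase_gate)"
    by (intro simulable_mult simulable_phase_gate) auto
  ultimately show ?thesis by simp
qed

lemma simulable_pauli_X: "simulable pauli_X"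
proof -
  have ZH: "pauli_Z * hadamard = sqrt_half \<cdot>\<^sub>m mat_of_rows_list 2 [[1, 1], [- 1, 1]]"
    unfolding hadamard_eq pauli_Z_def
    by (intro eq_mat_entriesI[of _ 2 _ 2]) (simp_all add: compute)
  have "hadamard * (pauli_Z * hadamard) = pauli_X"
    unfolding ZH unfolding hadamard_eq pauli_X_def
    by (intro eq_mat_entriesI[of _ 2 _ 2]) (simp_all add: compute sqrt_half_square)
  moreover have "simulable (hadamard * (pauli_Z * hadamard))"
    by (intro simulable_mult simulable_pauli_Z simulable_generators) auto
  ultimately show ?thesis by simp
qed

lemma simulable_pauli_Y: "simulable pauli_Y"
proof -
  have "pauli_X * pauli_Z = (- \<i>) \<cdot>\<^sub>m pauli_Y"
    by (intro eq_mat_entriesI[of _ 2 _ 2]) (simp_all add: pauli_X_def pauli_Y_def pauli_Z_def compute)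
  moreover have "simulable (pauli_X * pauli_Z)"
    by (intro simulable_mult simulable_pauli_X simulable_pauli_Z) auto
  ultimately show ?thesis using simulable_smult[of "- \<i>" pauli_Y] by auto
qed

text \<open>The control is duplicated and one copy is added to the target: |a,b> becomes |a,a,b> and
  then |a, a xor b>. The intermediate state has three wires, hence dimension 8.\<close>

lemma simulable_cnot: "simulable cnot"
proof -
  have C: "copy_tensor \<otimes>\<^sub>m wire = mat_of_rows_list 4
    [[1,0,0,0],[0,1,0,0],[0,0,0,0],[0,0,0,0],[0,0,0,0],[0,0,0,0],[0,0,1,0],[0,0,0,1]]"
    by (intro eq_mat_entriesI[of _ 8 _ 4])
      (simp_all add: tensor_defs compute)
  have X: "wire \<otimes>\<^sub>m xor_tensor = mat_of_rows_list 8
    [[1,0,0,1,0,0,0,0],[0,1,1,0,0,0,0,0],[0,0,0,0,1,0,0,1],[0,0,0,0,0,1,1,0]]"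
    by (intro eq_mat_entriesI[of _ 4 _ 8])
      (simp_all add: tensor_defs compute)
  have "(wire \<otimes>\<^sub>m xor_tensor) * (copy_tensor \<otimes>\<^sub>m wire) = cnot"
    unfolding C X
    by (intro eq_mat_entriesI[of _ 4 _ 4]) (simp_all add: cnot_def compute)
  moreover have "simulable ((wire \<otimes>\<^sub>m xor_tensor) * (copy_tensor \<otimes>\<^sub>m wire))"
    by (intro simulable_mult simulable_tensor_prod simulable_generators) auto
  ultimately show ?thesis by simp
qed

text \<open>The padding beside a placed gate may consist of no wires at all, and no clause of
  \<open>tensor_networks\<close> provides an empty network. A closed network with nonzero value
  takes its place in the base case.\<close>

lemma simulable_one: "simulable (1\<^sub>m (2 ^ n))"
proof (induction n)
  case 0
  have "plus_covector * t_vector = (1 + \<i>) \<cdot>\<^sub>m 1\<^sub>m (2 ^ 0)"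
    by (intro eq_matI) (auto simp: plus_covector_def t_vector_def compute)
  moreover have "simulable (plus_covector * t_vector)"
    by (intro simulable_mult simulable_generators) auto
  moreover have "1 + \<i> \<noteq> 0" by (simp add: complex_eq_iff)
  ultimately show ?case using simulable_smult[of "1 + \<i>" "1\<^sub>m (2 ^ 0)"] by auto
next
  case (Suc n)
  have "wire \<otimes>\<^sub>m 1\<^sub>m (2 ^ n) = 1\<^sub>m (2 ^ Suc n)"
  proof (rule eq_matI)
    fix i j
    assume "i < dim_row (1\<^sub>m (2 ^ Suc n))" "j < dim_col (1\<^sub>m (2 ^ Suc n))"
    then have ij: "i < 2 * 2 ^ n" "j < 2 * 2 ^ n" by auto
    have "i div 2 ^ n = j div 2 ^ n \<and> i mod 2 ^ n = j mod 2 ^ n \<longleftrightarrow> i = j"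
      by (metis div_mult_mod_eq)
    with ij div_mod_bounds[OF ij(1)] div_mod_bounds[OF ij(2)]
    show "(wire \<otimes>\<^sub>m 1\<^sub>m (2 ^ n)) $$ (i, j) = 1\<^sub>m (2 ^ Suc n) $$ (i, j)"
      by (auto simp: index_tensor_prod wire_def)
  qed auto
  with simulable_tensor_prod[OF simulable_generators(6) Suc.IH] show ?case by simp
qed

section \<open>Placing gates on qubits\<close>

lemma dim_on_qubits [simp]:
  "dim_row (on_qubits n qs A) = 2 ^ n" "dim_col (on_qubits n qs A) = 2 ^ n"
  by (auto simp: on_qubits_def)

lemma qubit_eqI:
  assumes "r < 2 ^ n" "s < 2 ^ n" "\<And>k. k < n \<Longrightarrow> qubit n r k = qubit n s k"
  shows "r = s"
proof (rule bit_eqI)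
  fix m
  show "bit r m = bit s m"
  proof (cases "m < n")
    case True
    then show ?thesis using assms(3)[of "n - 1 - m"] by (simp add: qubit_def)
  next
    case False
    have "take_bit n r = r" "take_bit n s = s"
      using assms by (auto simp: take_bit_nat_eq_self)
    then show ?thesis using False by (metis bit_take_bit_iff)
  qed
qed

lemma qubit_ket_index:
  assumes "length xs = n" "k < n"
  shows "qubit n (ket_index xs) k = xs ! k"
  using assms by (simp add: qubit_def ket_index_def bit_horner_sum_bit_iff rev_nth)

lemma ket_index_less: "ket_index xs < 2 ^ length xs"
  unfolding ket_index_def using horner_sum_of_bool_2_less[of "rev xs"] by simp

text \<open>Qubit 0 is the most significant bit, so qubits i to i+m-1 occupy the bit positions l to
  l+m-1. The reversal inside \<open>ket_index\<close> lists them from the lowest bit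
  upwards.\<close>

lemma ket_index_interval:
  "ket_index (map (qubit (i + m + l) r) [i..<i + m]) = take_bit m (drop_bit l r)"
proof -
  have "rev (map (qubit (i + m + l) r) [i..<i + m]) = map (bit (drop_bit l r)) [0..<m]"
    by (rule nth_equalityI) (auto simp: rev_nth qubit_def bit_drop_bit_eq intro!: arg_cong[of _ _ "bit r"])
  then show ?thesis
    by (simp add: ket_index_def horner_sum_bit_eq_take_bit)
qed

text \<open>The remaining qubits are the bit positions below l and those from m+l on. Positions from
  i+m+l on carry only zeros by the bounds on r and c, so dropping the low bits compares nothing more
  than the first i qubits.\<close>

lemma qubits_outside_interval_eq_iff:
  assumes "r < 2 ^ (i + m + l)" "c < 2 ^ (i + m + l)"
  shows "(\<forall>k<i + m + l. k \<notin> set [i..<i + m] \<longrightarrow> qubit (i + m + l) r k = qubit (i + m + l) c k)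
    \<longleftrightarrow> drop_bit (m + l) r = drop_bit (m + l) c \<and> take_bit l r = take_bit l c"
    (is "?L \<longleftrightarrow> ?R")
proof
  have high: "\<not> bit r k" "\<not> bit c k" if "k \<ge> i + m + l" for k
    using assms that by (metis bit_take_bit_iff not_less take_bit_nat_eq_self)+
  assume L: ?L
  have eq: "bit r j = bit c j" if "j < l \<or> j \<ge> m + l" for j
  proof (cases "j < i + m + l")
    case True
    have "i + m + l - 1 - (i + m + l - 1 - j) = j" using True by auto
    moreover have "i + m + l - 1 - j < i + m + l" "i + m + l - 1 - j \<notin> set [i..<i + m]"
      using True that by auto
    ultimately show ?thesis using L unfolding qubit_def by metis
  qed (use high in auto)
  show ?R
    by (auto intro!: bit_eqI simp: bit_drop_bit_eq bit_take_bit_iff eq)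
next
  assume R: ?R
  have eq: "bit r j = bit c j" if "j < l \<or> j \<ge> m + l" for j
  proof (cases "j < l")
    case True
    then show ?thesis using R by (metis bit_take_bit_iff)
  next
    case False
    then have "j = m + l + (j - (m + l))" using that by auto
    then show ?thesis using R by (metis bit_drop_bit_eq comp_apply)
  qed
  show ?L
    unfolding qubit_def by (intro allI impI eq) auto
qed

text \<open>An index splits into blocks of i, m and l bits, and the index formula of the tensor
  product splits it in the same way. The two identity factors force the outer blocks of row and
  column to agree.\<close>

lemma on_qubits_interval:
  assumes "A \<in> carrier_mat (2 ^ m) (2 ^ m)"
  shows "on_qubits (i + m + l) [i..<i + m] A = 1\<^sub>m (2 ^ i) \<otimes>\<^sub>m (A \<otimes>\<^sub>m 1\<^sub>m (2 ^ l))"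
proof (rule eq_matI)
  have [simp]: "dim_row A = 2 ^ m" "dim_col A = 2 ^ m" using assms by auto
  fix r c
  assume "r < dim_row (1\<^sub>m (2 ^ i) \<otimes>\<^sub>m (A \<otimes>\<^sub>m 1\<^sub>m (2 ^ l)))"
    and "c < dim_col (1\<^sub>m (2 ^ i) \<otimes>\<^sub>m (A \<otimes>\<^sub>m 1\<^sub>m (2 ^ l)))"
  then have rc: "r < 2 ^ (i + m + l)" "c < 2 ^ (i + m + l)"
    and rc': "r < 2 ^ i * (2 ^ m * 2 ^ l)" "c < 2 ^ i * (2 ^ m * 2 ^ l)"
    by (auto simp: power_add mult_ac)
  \<comment> \<open>This translates the bit blocks into the nested quotients and remainders that
    arise from the tensor product associated to the right.\<close>
  have tb: "take_bit m (drop_bit l x) = x mod (2 ^ m * 2 ^ l) div 2 ^ l"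
    "take_bit l x = x mod (2 ^ m * 2 ^ l) mod 2 ^ l"
    "drop_bit (m + l) x = x div (2 ^ m * 2 ^ l)" for x :: nat
  proof -
    show "take_bit m (drop_bit l x) = x mod (2 ^ m * 2 ^ l) div 2 ^ l"
      by (metis drop_bit_eq_div drop_bit_take_bit add_diff_cancel_right' power_add take_bit_eq_mod)
    show "take_bit l x = x mod (2 ^ m * 2 ^ l) mod 2 ^ l"
      by (simp add: take_bit_eq_mod mod_mod_cancel)
    show "drop_bit (m + l) x = x div (2 ^ m * 2 ^ l)"
      by (simp add: drop_bit_eq_div power_add)
  qed
  show "on_qubits (i + m + l) [i..<i + m] A $$ (r, c) =
    (1\<^sub>m (2 ^ i) \<otimes>\<^sub>m (A \<otimes>\<^sub>m 1\<^sub>m (2 ^ l))) $$ (r, c)"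
    \<comment> \<open>Removing \<open>set_upt\<close> keeps the condition on the other qubits in the
      form that \<open>qubits_outside_interval_eq_iff\<close> rewrites.\<close>
    using rc rc' div_mod_bounds[OF rc'(1)] div_mod_bounds[OF rc'(2)]
    by (simp add: on_qubits_def qubits_outside_interval_eq_iff ket_index_interval
        index_tensor_prod div_mod_bounds tb del: set_upt)
qed (use assms in \<open>auto simp: power_add\<close>)

lemma simulable_on_interval:
  assumes "simulable A" "A \<in> carrier_mat (2 ^ m) (2 ^ m)" "i + m \<le> n"
  shows "simulable (on_qubits n [i..<i + m] A)"
proof -
  have "n = i + m + (n - (i + m))" using assms(3) by auto
  then have "on_qubits n [i..<i + m] A =
    1\<^sub>m (2 ^ i) \<otimes>\<^sub>m (A \<otimes>\<^sub>m 1\<^sub>m (2 ^ (n - (i + m))))"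
    using on_qubits_interval[OF assms(2), of i "n - (i + m)"] by metis
  then show ?thesis
    using assms(1) by (auto intro!: simulable_tensor_prod simulable_one)
qed

section \<open>Exchanging two wires as a permutation of basis indices\<close>

definition swap_index :: "nat \<Rightarrow> nat \<Rightarrow> nat \<Rightarrow> nat \<Rightarrow> nat" where
  "swap_index n a b r = ket_index (map (\<lambda>k. qubit n r (transpose a b k)) [0..<n])"

lemma swap_index_less: "swap_index n a b r < 2 ^ n"
  using ket_index_less[of "map (\<lambda>k. qubit n r (transpose a b k)) [0..<n]"]
  by (simp add: swap_index_def)

lemma qubit_swap_index: "k < n \<Longrightarrow> qubit n (swap_index n a b r) k = qubit n r (transpose a b k)"
  by (simp add: swap_index_def qubit_ket_index)

lemma transpose_less: "a < n \<Longrightarrow> b < n \<Longrightarrow> k < n \<Longrightarrow> transpose a b k < (n :: nat)"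
  by (auto simp: transpose_def)

lemma eq_swap_index_iff:
  assumes "a < n" "b < n" "r < 2 ^ n" "c < 2 ^ n"
  shows "c = swap_index n a b r \<longleftrightarrow> (\<forall>k<n. qubit n c k = qubit n r (transpose a b k))"
  using assms by (auto simp: qubit_swap_index swap_index_less intro!: qubit_eqI)

lemma swap_index_involutory:
  assumes "a < n" "b < n" "r < 2 ^ n"
  shows "swap_index n a b (swap_index n a b r) = r"
  using assms
  by (auto intro!: qubit_eqI[of _ n] simp: swap_index_less qubit_swap_index transpose_less)

lemma wire_swap_index:
  "wire_swap $$ (ket_index [p, q], ket_index [u, v]) = of_bool (p = v \<and> q = u)"
  by (cases p; cases q; cases u; cases v)
    (simp_all add: ket_index_def wire_swap_def mat_of_rows_list_def numeral_3_eq_3)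

text \<open>The embedded swap is a permutation matrix: the unchanged outer bits and the two
  crosswise equalities together say that the bits of c are those of r permuted by the
  transposition.\<close>

lemma index_on_qubits_wire_swap:
  assumes "a < n" "b < n" "a \<noteq> b" "r < 2 ^ n" "c < 2 ^ n"
  shows "on_qubits n [a, b] wire_swap $$ (r, c) = of_bool (c = swap_index n a b r)"
proof -
  have eq: "(\<forall>k<n. qubit n c k = qubit n r (transpose a b k)) \<longleftrightarrow>
    (\<forall>k<n. k \<notin> set [a, b] \<longrightarrow> qubit n r k = qubit n c k) \<and>
    qubit n r a = qubit n c b \<and> qubit n r b = qubit n c a" (is "_ \<longleftrightarrow> ?P \<and> ?Q")
  proof
    assume L: "\<forall>k<n. qubit n c k = qubit n r (transpose a b k)"
    have "qubit n c k = qubit n r k" if "k < n" "k \<noteq> a" "k \<noteq> b" for k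
      using L that by (metis transpose_apply_other)
    with L assms(1,2) show "?P \<and> ?Q" by simp
  next
    assume R: "?P \<and> ?Q"
    show "\<forall>k<n. qubit n c k = qubit n r (transpose a b k)"
    proof (intro allI impI)
      fix k assume "k < n"
      with R show "qubit n c k = qubit n r (transpose a b k)"
        by (cases "k = a"; cases "k = b") simp_all
    qed
  qed
  have "on_qubits n [a, b] wire_swap $$ (r, c) = (if ?P then of_bool ?Q else 0)"
    using assms by (auto simp: on_qubits_def wire_swap_index)
  also have "\<dots> = of_bool (?P \<and> ?Q)" by simp
  also have "\<dots> = of_bool (c = swap_index n a b r)"
    unfolding eq_swap_index_iff[OF assms(1,2,4,5)] eq ..
  finally show ?thesis .
qed

text \<open>Relabelling qubits is conjugation by the permutation matrix of the swap. The swap is an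
  involution, so the same factor stands on both sides.\<close>

lemma on_qubits_transpose:
  assumes "a < n" "b < n" "a \<noteq> b" "set qs \<subseteq> {..<n}"
  shows "on_qubits n (map (transpose a b) qs) A =
    on_qubits n [a, b] wire_swap * (on_qubits n qs A * on_qubits n [a, b] wire_swap)"
    (is "?L = ?S * (?M * ?S)")
proof (rule eq_matI)
  fix r c
  assume "r < dim_row (?S * (?M * ?S))" "c < dim_col (?S * (?M * ?S))"
  then have rc: "r < 2 ^ n" "c < 2 ^ n" by auto
  let ?\<sigma> = "swap_index n a b"
  \<comment> \<open>Solving for the summation index k lets the sum over k collapse to a single
    term.\<close>
  have flip: "c = ?\<sigma> k \<longleftrightarrow> k = ?\<sigma> c" if "k < 2 ^ n" for k
    using swap_index_involutory assms rc that by metis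
  have MS: "(?M * ?S) $$ (k, c) = ?M $$ (k, ?\<sigma> c)" if "k < 2 ^ n" for k
    using that rc assms swap_index_less[of n a b]
    by (simp add: scalar_prod_def index_on_qubits_wire_swap flip of_bool_def if_distrib
        cong: if_cong)
  have "(?S * (?M * ?S)) $$ (r, c) = (\<Sum>k = 0..<2 ^ n. ?S $$ (r, k) * (?M * ?S) $$ (k, c))"
    using rc by (simp add: scalar_prod_def)
  \<comment> \<open>Here \<open>index_mult_mat\<close> is withheld so that the inner product stays
    folded and \<open>MS\<close> applies to it.\<close>
  also have "\<dots> = (\<Sum>k = 0..<2 ^ n. if k = ?\<sigma> r then ?M $$ (k, ?\<sigma> c) else 0)"
    using rc assms by (intro sum.cong) (auto simp: MS index_on_qubits_wire_swap simp del: index_mult_mat)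
  also have "\<dots> = ?M $$ (?\<sigma> r, ?\<sigma> c)"
    using swap_index_less[of n a b r] by simp
  also have "\<dots> = ?L $$ (r, c)"
  proof -
    \<comment> \<open>The transposition permutes the qubits below n, so renaming k by it turns one
      condition on the untouched qubits into the other.\<close>
    have "(\<forall>k<n. k \<notin> set qs \<longrightarrow> qubit n r (transpose a b k) = qubit n c (transpose a b k)) \<longleftrightarrow>
      (\<forall>k<n. k \<notin> transpose a b ` set qs \<longrightarrow> qubit n r k = qubit n c k)"
      (is "?P \<longleftrightarrow> ?Q")
    proof
      assume P: ?P
      show ?Q
      proof (intro allI impI)
        fix k assume k: "k < n" "k \<notin> transpose a b ` set qs"
        then have "transpose a b k \<notin> set qs"
          by (metis imageI transpose_involutory)
        with P k assms show "qubit n r k = qubit n c k"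
          by (metis transpose_involutory transpose_less)
      qed
    next
      assume Q: ?Q
      show ?P
      proof (intro allI impI)
        fix k assume k: "k < n" "k \<notin> set qs"
        then have "transpose a b k \<notin> transpose a b ` set qs"
          by (metis imageE transpose_involutory)
        with Q k assms show "qubit n r (transpose a b k) = qubit n c (transpose a b k)"
          by (metis transpose_less)
      qed
    qed
    moreover have "map (qubit n (?\<sigma> x)) qs = map (qubit n x) (map (transpose a b) qs)" for x
      using assms(4) by (auto simp: qubit_swap_index)
    ultimately show ?thesis
      using rc by (auto simp: on_qubits_def swap_index_less qubit_swap_index simp del: map_map)
  qed
  finally show "?L $$ (r, c) = (?S * (?M * ?S)) $$ (r, c)" by simp
qed auto

text \<open>Simulability of the embedded swap is a hypothesis because it is first known only for
  adjacent wires. The lemma serves for adjacent swaps and later for distant ones.\<close>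

lemma simulable_on_transpose:
  assumes "simulable (on_qubits n [a, b] wire_swap)" "simulable (on_qubits n qs A)"
    and "a < n" "b < n" "a \<noteq> b" "set qs \<subseteq> {..<n}"
  shows "simulable (on_qubits n (map (transpose a b) qs) A)"
  unfolding on_qubits_transpose[OF assms(3-6)]
  using assms(1,2) by (intro simulable_mult) auto

section \<open>One- and two-qubit gates on arbitrary qubits\<close>

lemma simulable_on_one:
  assumes "simulable A" "A \<in> carrier_mat 2 2" "i < n"
  shows "simulable (on_qubits n [i] A)"
  using simulable_on_interval[of A 1 i n] assms by simp

lemma simulable_on_adjacent:
  assumes "simulable A" "A \<in> carrier_mat 4 4" "Suc i < n"
  shows "simulable (on_qubits n [i, Suc i] A)"
  using simulable_on_interval[of A 2 i n] assms by (simp add: upt_rec)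

text \<open>The second qubit is moved one place at a time: if i < j, conjugating with the swap of j
  and j+1 fixes i and carries the gate from (i, j) to (i, j+1).\<close>

lemma simulable_on_ordered_pair:
  assumes "simulable A" "A \<in> carrier_mat 4 4" "i < j" "j < n"
  shows "simulable (on_qubits n [i, j] A)"
  using assms(3,4)
proof (induction j)
  case (Suc j)
  show ?case
  proof (cases "i = j")
    case True
    then show ?thesis using simulable_on_adjacent assms(1,2) Suc.prems by auto
  next
    case False
    have "simulable (on_qubits n (map (transpose j (Suc j)) [i, j]) A)"
      using False Suc
      by (intro simulable_on_transpose simulable_on_adjacent simulable_generators) auto
    then show ?thesis using False Suc.prems by simp
  qed
qed simp

text \<open>If j < i, the gate is first placed on (j, i) and then conjugated with the swap of these
  two qubits. That swap is symmetric in its wires and is itself a gate on an ordered pair, hence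
  already simulable.\<close>

lemma simulable_on_pair:
  assumes "simulable A" "A \<in> carrier_mat 4 4" "i \<noteq> j" "i < n" "j < n"
  shows "simulable (on_qubits n [i, j] A)"
proof (cases "i < j")
  case True
  then show ?thesis using assms simulable_on_ordered_pair by auto
next
  case False
  have "simulable (on_qubits n (map (transpose j i) [j, i]) A)"
    using False assms
    by (intro simulable_on_transpose simulable_on_ordered_pair simulable_generators) auto
  then show ?thesis by simp
qed

section \<open>Stabilizer gates and circuits\<close>

lemma simulable_gate_operator:
  assumes "valid_gate n g"
  shows "simulable (gate_operator n g)"
  using assms
  by (cases g)
    (auto intro!: simulable_on_one simulable_on_pair simulable_generators simulable_phase_gate
      simulable_pauli_X simulable_pauli_Y simulable_pauli_Z simulable_cnot)

lemma dim_gate_operator [simp]: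
  "dim_row (gate_operator n g) = 2 ^ n"
  "dim_col (gate_operator n g) = 2 ^ n"
  by (cases g; simp)+

lemma dim_col_circuit_operator [simp]: "dim_col (circuit_operator n gs) = 2 ^ n"
  by (cases gs) auto

lemma simulable_circuit_operator:
  assumes "stabilizer_circuit n gs"
  shows "simulable (circuit_operator n gs)"
  using assms
proof (induction gs)
  case (Cons g gs)
  then show ?case
    by (auto simp: stabilizer_circuit_def intro!: simulable_mult simulable_gate_operator)
qed (simp add: simulable_one)

theorem theorem5:
  fixes n :: nat and gs :: "stabilizer_gate list"
  assumes "stabilizer_circuit n gs"
  shows "\<exists>N c. N \<in> tensor_networks generating_tensors \<and> c \<noteq> 0 \<and>
           N = c \<cdot>\<^sub>m circuit_operator n gs"
  using simulable_circuit_operator[OF assms] unfolding simulable_def by blast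

end
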